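(* Let $S$ be a finite non-empty set and $B\subseteq\mathbb{R}^S$ an integral base-polyhedron. An element $m$ of $B\cap\mathbb{Z}^S$ minimizes the difference-sum $\Delta(z)=\sum\{|z(s)-z(t)|: s\ne t,\ s,t\in S\}$ over $B\cap\mathbb{Z}^S$ if and only if $m$ is a decreasingly minimal element of $B\cap\mathbb{Z}^S$.
   Context: An integral base-polyhedron is $B=\{x\in\mathbb{R}^S:\widetilde x(S)=b(S),\ \widetilde x(Z)\le b(Z)\ \forall Z\subseteq S\}$ for an integer-valued submodular $b$ ($+\infty$ allowed) with $b(\emptyset)=0$, $b(S)$ finite; $\widetilde x(Z)=\sum_{s\in Z}x(s)$. An element $m$ of a set $Q$ is decreasingly minimal if, after sorting components in decreasing order, it is lexicographically smaller than or equal to every $y\in Q$ sorted likewise. *)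

theory Defs
  imports "HOL-Analysis.Analysis" "HOL-Library.Multiset"
begin

text \<open>The ground set \<open>S\<close> is the universe of the finite type \<open>'s\<close>, so that \<open>R^S\<close> is \<^typ>\<open>real ^ 's\<close>.\<close>

definition vec_sum :: "real ^ 's::finite \<Rightarrow> 's set \<Rightarrow> real" where
  "vec_sum x Z = (\<Sum>s\<in>Z. x $ s)"

definition submodular :: "('s::finite set \<Rightarrow> ereal) \<Rightarrow> bool" where
  "submodular b \<longleftrightarrow> (\<forall>X Y. b (X \<inter> Y) + b (X \<union> Y) \<le> b X + b Y)"

definition integer_valued :: "('s::finite set \<Rightarrow> ereal) \<Rightarrow> bool" where
  "integer_valued b \<longleftrightarrow> (\<forall>Z. b Z = \<infinity> \<or> (\<exists>k::int. b Z = ereal (of_int k)))"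

definition base_polyhedron :: "('s::finite set \<Rightarrow> ereal) \<Rightarrow> (real ^ 's) set" where
  "base_polyhedron b =
     {x. ereal (vec_sum x UNIV) = b UNIV \<and> (\<forall>Z. ereal (vec_sum x Z) \<le> b Z)}"

definition integral_base_polyhedron :: "(real ^ 's::finite) set \<Rightarrow> bool" where
  "integral_base_polyhedron B \<longleftrightarrow>
     (\<exists>b. integer_valued b \<and> submodular b \<and> b {} = 0 \<and> b UNIV \<noteq> \<infinity> \<and> B = base_polyhedron b)"

definition integer_vectors :: "(real ^ 's::finite) set" where
  "integer_vectors = {x. \<forall>s. x $ s \<in> \<int>}"

definition dec_sorted :: "real ^ 's::finite \<Rightarrow> real list" where
  "dec_sorted x = rev (sorted_list_of_multiset (image_mset (\<lambda>s. x $ s) (mset_set UNIV)))"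

definition dec_le :: "real ^ 's::finite \<Rightarrow> real ^ 's \<Rightarrow> bool" where
  "dec_le x y \<longleftrightarrow>
     dec_sorted x = dec_sorted y \<or> (dec_sorted x, dec_sorted y) \<in> lexord {(u, v). u < v}"

definition decreasingly_minimal :: "(real ^ 's::finite) set \<Rightarrow> real ^ 's \<Rightarrow> bool" where
  "decreasingly_minimal Q m \<longleftrightarrow> m \<in> Q \<and> (\<forall>y\<in>Q. dec_le m y)"

text \<open>The sum ranges over ordered pairs; summing over unordered pairs would only halve it.\<close>

definition difference_sum :: "real ^ 's::finite \<Rightarrow> real" where
  "difference_sum z = (\<Sum>(s, t)\<in>{(s, t). s \<noteq> t}. \<bar>z $ s - z $ t\<bar>)"

definition minimizes_over :: "('b \<Rightarrow> real) \<Rightarrow> 'b set \<Rightarrow> 'b \<Rightarrow> bool" where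
  "minimizes_over f Q m \<longleftrightarrow> m \<in> Q \<and> (\<forall>y\<in>Q. f m \<le> f y)"

end

theory Submission imports Defs begin

text \<open>
  Call a step from \<open>z\<close> to \<open>z + e\<^sub>s - e\<^sub>t\<close> with \<open>z(t) \<ge> z(s) + 2\<close> a tightening step. It strictly
  decreases both the difference-sum and the decreasing order, so a minimizer of either kind admits
  no tightening step inside the set. Conversely, suppose \<open>m\<close> admits none and \<open>y\<close> is another
  integral point. If \<open>m(s) > y(s)\<close>, simultaneous exchange yields \<open>t\<close> with \<open>m(t) < y(t)\<close> such that
  \<open>m - e\<^sub>s + e\<^sub>t\<close> and \<open>y + e\<^sub>s - e\<^sub>t\<close> are in the set; then \<open>y(s) + 1 \<le> m(s) \<le> m(t) + 1 \<le> y(t)\<close>, so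
  that passing from \<open>y\<close> to \<open>y + e\<^sub>s - e\<^sub>t\<close> is a tightening step or swaps two values. It moves \<open>y\<close>
  towards \<open>m\<close> and does not increase either objective, and one concludes by induction on the distance.
\<close>

definition transfer :: "real ^ 's::finite \<Rightarrow> 's \<Rightarrow> 's \<Rightarrow> real ^ 's" where
  "transfer z s t = z + axis s 1 - axis t 1"

lemma transfer_nth:
  "transfer z s t $ i = z $ i + (if i = s then 1 else 0) - (if i = t then 1 else 0)"
  by (simp add: transfer_def axis_def)

lemma transfer_integer: "z \<in> integer_vectors \<Longrightarrow> transfer z s t \<in> integer_vectors"
  by (auto simp: integer_vectors_def transfer_nth)

lemma vec_sum_transfer:
  "vec_sum (transfer z s t) Z = vec_sum z Z + (if s \<in> Z then 1 else 0) - (if t \<in> Z then 1 else 0)"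
  by (simp add: vec_sum_def transfer_nth sum.distrib sum_subtractf)

lemma vec_sum_integer: "z \<in> integer_vectors \<Longrightarrow> vec_sum z Z \<in> \<int>"
  by (auto simp: vec_sum_def integer_vectors_def intro: Ints_sum)

lemma vec_sum_modular: "vec_sum z (X \<inter> Y) + vec_sum z (X \<union> Y) = vec_sum z X + vec_sum z Y"
  unfolding vec_sum_def by (metis add.commute finite sum.union_inter)

subsection \<open>Simultaneous exchange\<close>

definition tight :: "('s::finite set \<Rightarrow> ereal) \<Rightarrow> real ^ 's \<Rightarrow> 's set \<Rightarrow> bool" where
  "tight b z Z \<longleftrightarrow> b Z = ereal (vec_sum z Z)"

lemma base_polyhedronD: "z \<in> base_polyhedron b \<Longrightarrow> ereal (vec_sum z Z) \<le> b Z"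
  by (simp add: base_polyhedron_def)

text \<open>Uncrossing: submodularity bounds the two values of \<open>b\<close> together by the sum
  of the two values of \<open>z\<close>, while each single value of \<open>b\<close> is at least
  that of \<open>z\<close>. Hence both are finite and both inequalities are equalities.\<close>

lemma tight_Int_Un:
  assumes sub: "submodular b" and z: "z \<in> base_polyhedron b"
    and X: "tight b z X" and Y: "tight b z Y"
  shows "tight b z (X \<inter> Y)" "tight b z (X \<union> Y)"
proof -
  have *: "b (X \<inter> Y) + b (X \<union> Y) \<le> ereal (vec_sum z (X \<inter> Y) + vec_sum z (X \<union> Y))"
    using sub X Y unfolding submodular_def tight_def vec_sum_modular by (metis plus_ereal.simps(1))
  have "ereal (vec_sum z (X \<inter> Y)) \<le> b (X \<inter> Y)" "ereal (vec_sum z (X \<union> Y)) \<le> b (X \<union> Y)"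
    using z by (auto intro: base_polyhedronD)
  with * show "tight b z (X \<inter> Y)" "tight b z (X \<union> Y)"
    unfolding tight_def by (cases "b (X \<inter> Y)"; cases "b (X \<union> Y)"; simp)+
qed

text \<open>Only sets containing \<open>s\<close> but not \<open>t\<close> gain from the transfer.
  By \<open>free\<close> such a set is not tight, and by integrality its slack is then at least 1,
  which is exactly what the transfer uses up.\<close>

lemma transfer_in_base_polyhedron:
  assumes b: "integer_valued b" and z: "z \<in> base_polyhedron b" "z \<in> integer_vectors"
    and free: "\<And>Z. tight b z Z \<Longrightarrow> s \<in> Z \<Longrightarrow> t \<in> Z"
  shows "transfer z s t \<in> base_polyhedron b"
proof -
  have "ereal (vec_sum (transfer z s t) Z) \<le> b Z" for Z
  proof (cases "s \<in> Z \<and> t \<notin> Z")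
    case True
    have le: "ereal (vec_sum z Z) \<le> b Z" using z(1) by (rule base_polyhedronD)
    have ne: "b Z \<noteq> ereal (vec_sum z Z)" using free True by (auto simp: tight_def)
    obtain i where i: "vec_sum z Z = of_int i" using vec_sum_integer[OF z(2)] by (metis Ints_cases)
    have "b Z = \<infinity> \<or> (\<exists>k::int. b Z = ereal (of_int k))" using b by (auto simp: integer_valued_def)
    then show ?thesis
    proof
      assume "\<exists>k::int. b Z = ereal (of_int k)"
      then obtain k :: int where k: "b Z = ereal (of_int k)" by blast
      have "i + 1 \<le> k" using le ne unfolding k i by simp
      then have "real_of_int (i + 1) \<le> of_int k" by (simp only: of_int_le_iff)
      then show ?thesis using True by (simp add: vec_sum_transfer k i)
    qed simp
  next
    case False
    then have "vec_sum (transfer z s t) Z \<le> vec_sum z Z" by (auto simp: vec_sum_transfer)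
    then show ?thesis
      using base_polyhedronD[OF z(1), of Z] by (meson ereal_less_eq(3) order_trans)
  qed
  then show ?thesis
    using z(1) by (simp add: base_polyhedron_def vec_sum_transfer)
qed

text \<open>By uncrossing there are a least \<open>y\<close>-tight set \<open>T\<close> containing
  \<open>s\<close> and a greatest \<open>x\<close>-tight set \<open>U\<close> avoiding
  \<open>s\<close>. Any \<open>t\<close> in \<open>T - U\<close> makes both transfers feasible, so
  it remains to find one with \<open>x $ t < y $ t\<close>.\<close>

lemma simultaneous_exchange:
  assumes b: "integer_valued b" "submodular b" "b {} = 0"
    and x: "x \<in> base_polyhedron b" "x \<in> integer_vectors"
    and y: "y \<in> base_polyhedron b" "y \<in> integer_vectors"
    and s: "y $ s < x $ s"
  obtains t where "x $ t < y $ t" "transfer x t s \<in> base_polyhedron b"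
    "transfer y s t \<in> base_polyhedron b"
proof -
  have "{Z. tight b y Z \<and> s \<in> Z} \<noteq> {}"
    using y(1) by (auto simp: tight_def base_polyhedron_def intro!: exI[of _ UNIV])
  then obtain T where T: "tight b y T" "s \<in> T"
      and T_min: "\<And>Z. tight b y Z \<Longrightarrow> s \<in> Z \<Longrightarrow> Z \<subseteq> T \<Longrightarrow> T = Z"
    using finite_has_minimal[of "{Z. tight b y Z \<and> s \<in> Z}"] by auto
  have T_le: "T \<subseteq> Z" if "tight b y Z" "s \<in> Z" for Z
    using T_min[of "T \<inter> Z"] tight_Int_Un(1)[OF b(2) y(1) T(1) that(1)] T(2) that(2) by auto
  have "{Z. tight b x Z \<and> s \<notin> Z} \<noteq> {}"
    using b(3) by (auto simp: tight_def vec_sum_def intro!: exI[of _ "{}"])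
  then obtain U where U: "tight b x U" "s \<notin> U"
      and U_max: "\<And>Z. tight b x Z \<Longrightarrow> s \<notin> Z \<Longrightarrow> U \<subseteq> Z \<Longrightarrow> U = Z"
    using finite_has_maximal[of "{Z. tight b x Z \<and> s \<notin> Z}"] by auto
  have U_ge: "Z \<subseteq> U" if "tight b x Z" "s \<notin> Z" for Z
    using U_max[of "U \<union> Z"] tight_Int_Un(2)[OF b(2) x(1) U(1) that(1)] U(2) that(2) by auto
  have "\<exists>t\<in>T - U. x $ t < y $ t"
  proof (rule ccontr)
    assume "\<not> ?thesis"
    then have "\<forall>t\<in>T - U. y $ t \<le> x $ t" by force
    then have less: "vec_sum y (T - U) < vec_sum x (T - U)"
      unfolding vec_sum_def using s T(2) U(2) by (intro sum_strict_mono_ex1) auto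
    \<comment> \<open>The constraint of \<open>y\<close> is taken on the intersection and that of
      \<open>x\<close> on the union. Against the tightness of \<open>T\<close> and \<open>U\<close>
      this leaves \<open>x(T - U) \<le> y(T - U)\<close>, contradicting \<open>less\<close>, whose
      strictness comes from \<open>s\<close> itself.\<close>
    have "ereal (vec_sum y (T \<inter> U) + vec_sum x (T \<union> U)) \<le> b (T \<inter> U) + b (T \<union> U)"
      using add_mono[OF base_polyhedronD[OF y(1)] base_polyhedronD[OF x(1)]] by simp
    also have "\<dots> \<le> b T + b U" using b(2) by (simp add: submodular_def)
    also have "\<dots> = ereal (vec_sum y T + vec_sum x U)" using T(1) U(1) by (simp add: tight_def)
    finally have "vec_sum y (T \<inter> U) + vec_sum x (T \<union> U) \<le> vec_sum y T + vec_sum x U" by simp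
    moreover have "vec_sum x (T \<union> U) = vec_sum x U + vec_sum x (T - U)"
      unfolding vec_sum_def
      by (subst sum.union_disjoint[symmetric]) (auto intro!: sum.cong)
    moreover have "vec_sum y T = vec_sum y (T \<inter> U) + vec_sum y (T - U)"
      unfolding vec_sum_def
      by (subst sum.union_disjoint[symmetric]) (auto intro!: sum.cong)
    ultimately show False using less by simp
  qed
  then obtain t where t: "t \<in> T" "t \<notin> U" "x $ t < y $ t" by blast
  show thesis
  proof
    show "x $ t < y $ t" by fact
    show "transfer x t s \<in> base_polyhedron b"
      using transfer_in_base_polyhedron[OF b(1) x] U_ge t(2) by blast
    show "transfer y s t \<in> base_polyhedron b"
      using transfer_in_base_polyhedron[OF b(1) y] T_le t(1) by blast
  qed
qed

subsection \<open>Effect of a transfer on the difference-sum\<close>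

lemma difference_sum_double_sum: "difference_sum z = (\<Sum>i\<in>UNIV. \<Sum>j\<in>UNIV. \<bar>z $ i - z $ j\<bar>)"
proof -
  have "difference_sum z = (\<Sum>(i, j)\<in>UNIV \<times> UNIV. \<bar>z $ i - z $ j\<bar>)"
    unfolding difference_sum_def by (rule sum.mono_neutral_left) auto
  then show ?thesis by (simp add: sum.cartesian_product)
qed

lemma sum_UNIV_split_two:
  fixes f :: "'s::finite \<Rightarrow> real"
  assumes "s \<noteq> t"
  shows "sum f UNIV = f s + f t + sum f (- {s, t})"
proof -
  have "sum f UNIV = sum f ({s, t} \<union> - {s, t})" by simp
  also have "\<dots> = sum f {s, t} + sum f (- {s, t})" by (intro sum.union_disjoint) auto
  finally show ?thesis using assms by simp
qed

text \<open>Separates the pairs affected by a transfer between \<open>s\<close> and \<open>t\<close>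
  from the rest; the factors 2 arise because pairs are ordered.\<close>

lemma difference_sum_split_two:
  assumes "s \<noteq> t"
  shows "difference_sum z = 2 * \<bar>z $ t - z $ s\<bar>
    + 2 * (\<Sum>i\<in>- {s, t}. \<bar>z $ i - z $ s\<bar> + \<bar>z $ i - z $ t\<bar>)
    + (\<Sum>i\<in>- {s, t}. \<Sum>j\<in>- {s, t}. \<bar>z $ i - z $ j\<bar>)"
  unfolding difference_sum_double_sum sum_UNIV_split_two[OF assms] sum.distrib
  by (simp add: abs_minus_commute)

text \<open>The two new values stay between the old ones and have the same sum, so by convexity of
  the absolute value no third element contributes more. The subtracted term is 0 for a gap of 1 and
  4 for a gap of at least 2, which covers swaps and tightening steps at once.\<close>

lemma difference_sum_transfer_le:
  assumes "z $ s + 1 \<le> z $ t"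
  shows "difference_sum (transfer z s t)
    \<le> difference_sum z - 2 * (\<bar>z $ t - z $ s\<bar> - \<bar>z $ t - z $ s - 2\<bar>)"
proof -
  have st: "s \<noteq> t" using assms by auto
  let ?z = "transfer z s t"
  have nth: "?z $ s = z $ s + 1" "?z $ t = z $ t - 1" "\<And>i. i \<in> - {s, t} \<Longrightarrow> ?z $ i = z $ i"
    using st by (auto simp: transfer_nth)
  have "(\<Sum>i\<in>- {s, t}. \<bar>?z $ i - ?z $ s\<bar> + \<bar>?z $ i - ?z $ t\<bar>)
      \<le> (\<Sum>i\<in>- {s, t}. \<bar>z $ i - z $ s\<bar> + \<bar>z $ i - z $ t\<bar>)"
  proof (rule sum_mono)
    fix i assume "i \<in> - {s, t}"
    then show "\<bar>?z $ i - ?z $ s\<bar> + \<bar>?z $ i - ?z $ t\<bar> \<le> \<bar>z $ i - z $ s\<bar> + \<bar>z $ i - z $ t\<bar>"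
      using assms by (simp add: nth)
  qed
  moreover have "(\<Sum>i\<in>- {s, t}. \<Sum>j\<in>- {s, t}. \<bar>?z $ i - ?z $ j\<bar>)
      = (\<Sum>i\<in>- {s, t}. \<Sum>j\<in>- {s, t}. \<bar>z $ i - z $ j\<bar>)"
    by (intro sum.cong refl) (simp add: nth)
  moreover have "\<bar>?z $ t - ?z $ s\<bar> = \<bar>z $ t - z $ s - 2\<bar>" by (simp add: nth algebra_simps)
  ultimately show ?thesis
    unfolding difference_sum_split_two[OF st] by simp
qed

subsection \<open>Effect of a transfer on the decreasing order\<close>

lemma mset_dec_sorted: "mset (dec_sorted z) = image_mset (($) z) (mset_set UNIV)"
  by (simp add: dec_sorted_def)

lemma length_dec_sorted: "length (dec_sorted (z :: real ^ 's::finite)) = CARD('s)"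
  using arg_cong[OF mset_dec_sorted[of z], of size] by simp

lemma dec_sorted_sorted: "sorted_wrt (\<ge>) (dec_sorted z)"
  unfolding dec_sorted_def sorted_wrt_rev by simp

lemma mset_dec_sorted_split_two:
  assumes "s \<noteq> t"
  shows "mset (dec_sorted z) = {#z $ s, z $ t#} + image_mset (($) z) (mset_set (- {s, t}))"
proof -
  have "mset_set (UNIV :: 'a set) = mset_set (insert s (insert t (- {s, t})))"
    by (intro arg_cong[of _ _ mset_set]) auto
  also have "\<dots> = {#s, t#} + mset_set (- {s, t})" using assms by simp
  finally show ?thesis by (simp add: mset_dec_sorted)
qed

lemma mset_dec_sorted_transfer:
  assumes "s \<noteq> t"
  shows "mset (dec_sorted (transfer z s t))
    = {#z $ s + 1, z $ t - 1#} + image_mset (($) z) (mset_set (- {s, t}))"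
proof -
  have "image_mset (($) (transfer z s t)) (mset_set (- {s, t})) = image_mset (($) z) (mset_set (- {s, t}))"
    by (intro image_mset_cong) (simp add: transfer_nth)
  then show ?thesis
    unfolding mset_dec_sorted_split_two[OF assms] using assms by (simp add: transfer_nth)
qed

lemma dec_sorted_cong:
  assumes "mset (dec_sorted x) = mset (dec_sorted y)"
  shows "dec_sorted x = dec_sorted y"
  using assms by (simp add: dec_sorted_def)

text \<open>Take for \<open>v\<close> the entry of \<open>ys\<close> at the first difference. After
  the common prefix \<open>xs\<close> has only entries below \<open>v\<close>, and \<open>ys\<close>
  none above it. This reduces comparisons of sorted lists to multiplicities.\<close>

lemma lexord_decreasing_count:
  fixes xs ys :: "real list"
  assumes lex: "(xs, ys) \<in> lexord {(u, v). u < v}" and len: "length xs = length ys"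
    and sorted: "sorted_wrt (\<ge>) xs" "sorted_wrt (\<ge>) ys"
  obtains v where "count (mset xs) v < count (mset ys) v"
    "\<And>w. v < w \<Longrightarrow> count (mset xs) w = count (mset ys) w"
proof -
  from lex consider a r where "ys = xs @ a # r"
    | p u v r r' where "u < v" "xs = p @ u # r" "ys = p @ v # r'"
    unfolding lexord_def by auto
  then show thesis
  proof cases
    case 1
    then show ?thesis using len by simp
  next
    case 2
    have r: "w \<notin> set r" if "v \<le> w" for w
      using sorted(1) 2 that by (force simp: sorted_wrt_append)
    have r': "w \<notin> set r'" if "v < w" for w
      using sorted(2) 2 that by (force simp: sorted_wrt_append)
    show ?thesis
    proof
      show "count (mset xs) v < count (mset ys) v"
        using 2 r[of v] by (auto simp: count_eq_zero_iff[THEN iffD2])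
      show "count (mset xs) w = count (mset ys) w" if "v < w" for w
        using 2 that r[of w] r'[of w] by (auto simp: count_eq_zero_iff[THEN iffD2])
    qed
  qed
qed

lemma dec_sorted_tightening:
  assumes "z $ s + 2 \<le> z $ t"
  shows "(dec_sorted (transfer z s t), dec_sorted z) \<in> lexord {(u, v). u < v}"
proof (rule ccontr)
  have st: "s \<noteq> t" using assms by auto
  note counts = mset_dec_sorted_split_two[OF st, of z] mset_dec_sorted_transfer[OF st, of z]
  have top: "count (mset (dec_sorted z)) (z $ t) = Suc (count (mset (dec_sorted (transfer z s t))) (z $ t))"
    unfolding counts using assms by auto
  assume "\<not> ?thesis"
  moreover have "dec_sorted (transfer z s t) \<noteq> dec_sorted z" using top by force
  ultimately have "(dec_sorted z, dec_sorted (transfer z s t)) \<in> lexord {(u, v). u < v}"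
    using lexord_linear[of "{(u :: real, v). u < v}" "dec_sorted (transfer z s t)" "dec_sorted z"] by force
  then obtain v where v: "count (mset (dec_sorted z)) v < count (mset (dec_sorted (transfer z s t))) v"
    and above: "\<And>w. v < w \<Longrightarrow>
      count (mset (dec_sorted z)) w = count (mset (dec_sorted (transfer z s t))) w"
    by (rule lexord_decreasing_count) (simp_all add: length_dec_sorted dec_sorted_sorted)
  \<comment> \<open>Only the values \<open>z $ s + 1\<close> and \<open>z $ t - 1\<close> can gain
    multiplicity, and both lie below \<open>z $ t\<close>.\<close>
  have "v < z $ t"
    using v assms unfolding counts by (auto split: if_splits)
  from above[OF this] top show False by simp
qed

lemma dec_sorted_swap:
  assumes "z $ s + 1 = z $ t"
  shows "dec_sorted (transfer z s t) = dec_sorted z"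
proof (rule dec_sorted_cong)
  have st: "s \<noteq> t" using assms by auto
  show "mset (dec_sorted (transfer z s t)) = mset (dec_sorted z)"
    unfolding mset_dec_sorted_split_two[OF st, of z] mset_dec_sorted_transfer[OF st]
    using assms by (simp add: algebra_simps flip: assms)
qed

lemma trans_less: "trans {(u :: real, v). u < v}"
  by (auto intro: transI)

lemma dec_le_trans: "dec_le x y \<Longrightarrow> dec_le y z \<Longrightarrow> dec_le x z"
  unfolding dec_le_def using lexord_trans[OF _ _ trans_less] by metis

lemma not_dec_le_if_lexord:
  assumes "(dec_sorted y, dec_sorted x) \<in> lexord {(u, v). u < v}"
  shows "\<not> dec_le x y"
proof
  have irrefl: "(xs, xs) \<notin> lexord {(u :: real, v). u < v}" for xs
    by (rule lexord_irreflexive) auto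
  assume "dec_le x y"
  then have "(dec_sorted y, dec_sorted y) \<in> lexord {(u, v). u < v}"
    unfolding dec_le_def
    using assms lexord_trans[OF assms _ trans_less] by metis
  then show False using irrefl by blast
qed

subsection \<open>Local optimality is global\<close>

text \<open>The offset \<open>c\<close> serves to sharpen both \<open>a < b\<close> (with 0) and
  \<open>a + 1 < b\<close> (with 1) by one unit.\<close>

lemma integer_vectors_less_iff:
  assumes "z \<in> integer_vectors" "w \<in> integer_vectors"
  shows "z $ i + of_int c < w $ j \<longleftrightarrow> z $ i + of_int c + 1 \<le> w $ j"
proof -
  obtain k l where "z $ i = of_int k" "w $ j = of_int l"
    using assms unfolding integer_vectors_def by (metis Ints_cases mem_Collect_eq)
  then show ?thesis using int_less_real_le[of "k + c" l] by simp linarith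
qed

text \<open>Both changed coordinates move one unit towards \<open>m\<close> without overshooting;
  this is the decrease of the induction measure below.\<close>

lemma transfer_towards:
  assumes "y $ s + 1 \<le> m $ s" "m $ t + 1 \<le> y $ t"
  shows "(\<Sum>i\<in>UNIV. \<bar>m $ i - transfer y s t $ i\<bar>) = (\<Sum>i\<in>UNIV. \<bar>m $ i - y $ i\<bar>) - 2"
proof -
  have st: "s \<noteq> t" using assms by auto
  have "(\<Sum>i\<in>- {s, t}. \<bar>m $ i - transfer y s t $ i\<bar>) = (\<Sum>i\<in>- {s, t}. \<bar>m $ i - y $ i\<bar>)"
    by (intro sum.cong refl) (simp add: transfer_nth)
  then show ?thesis
    unfolding sum_UNIV_split_two[OF st] using st assms by (simp add: transfer_nth)
qed

lemma no_tightening_imp_minimal: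
  fixes m y :: "real ^ 's::finite"
  assumes b: "integer_valued b" "submodular b" "b {} = 0"
    and m: "m \<in> base_polyhedron b" "m \<in> integer_vectors"
    and local: "\<And>s t. m $ s + 2 \<le> m $ t \<Longrightarrow> transfer m s t \<notin> base_polyhedron b"
    and y: "y \<in> base_polyhedron b" "y \<in> integer_vectors"
  shows "difference_sum m \<le> difference_sum y \<and> dec_le m y"
  using y
\<comment> \<open>The distance is a real number; its floor gives a well-founded measure, and a drop
  by 2 survives the rounding.\<close>
proof (induction "nat \<lfloor>\<Sum>i\<in>UNIV. \<bar>m $ i - y $ i\<bar>\<rfloor>" arbitrary: y rule: less_induct)
  case less
  show ?case
  proof (cases "\<exists>s. y $ s < m $ s")
    case False
    \<comment> \<open>Componentwise domination together with equal total sums forces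
      \<open>m = y\<close>.\<close>
    then have "\<forall>i. m $ i \<le> y $ i" by (simp add: not_less)
    moreover have "vec_sum m UNIV = vec_sum y UNIV"
      using m(1) less.prems(1) by (metis (mono_tags, lifting) base_polyhedron_def ereal.inject mem_Collect_eq)
    ultimately have "m $ i = y $ i" for i
      unfolding vec_sum_def by (intro sum_mono_inv[of "($) m" UNIV "($) y"]) simp_all
    then have "m = y" by (simp add: vec_eq_iff)
    then show ?thesis by (simp add: dec_le_def)
  next
    case True
    then obtain s where s: "y $ s < m $ s" by blast
    obtain t where t: "m $ t < y $ t" "transfer m t s \<in> base_polyhedron b"
        "transfer y s t \<in> base_polyhedron b"
      using simultaneous_exchange[OF b m less.prems s] by blast
    let ?y = "transfer y s t"
    note int = integer_vectors_less_iff
    have st: "y $ s + 1 \<le> m $ s" "m $ t + 1 \<le> y $ t"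
      using s t(1) int[OF less.prems(2) m(2), of s 0 s] int[OF m(2) less.prems(2), of t 0 t] by auto
    have "\<not> m $ t + 2 \<le> m $ s" using local t(2) by blast
    then have "m $ s \<le> m $ t + 1" using int[OF m(2) m(2), of t 1 s] by simp
    then have gap: "y $ s + 1 \<le> y $ t" using st by linarith
    have "0 \<le> (\<Sum>i\<in>UNIV. \<bar>m $ i - ?y $ i\<bar>)" by (intro sum_nonneg) auto
    then have "nat \<lfloor>\<Sum>i\<in>UNIV. \<bar>m $ i - ?y $ i\<bar>\<rfloor> < nat \<lfloor>\<Sum>i\<in>UNIV. \<bar>m $ i - y $ i\<bar>\<rfloor>"
      unfolding transfer_towards[OF st] by linarith
    then have IH: "difference_sum m \<le> difference_sum ?y \<and> dec_le m ?y"
      using less.hyps t(3) transfer_integer[OF less.prems(2)] by blast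
    have "difference_sum ?y \<le> difference_sum y"
      using difference_sum_transfer_le[OF gap] gap by (simp add: abs_if split: if_splits)
    moreover have "dec_le ?y y"
    proof (cases "y $ s + 1 = y $ t")
      case True
      then show ?thesis by (simp add: dec_le_def dec_sorted_swap)
    next
      case False
      then have "y $ s + 2 \<le> y $ t"
        using int[OF less.prems(2) less.prems(2), of s 1 t] gap by simp
      then show ?thesis by (simp add: dec_le_def dec_sorted_tightening)
    qed
    ultimately show ?thesis using IH dec_le_trans by force
  qed
qed

theorem theorem6p7:
  fixes B :: "(real ^ 's::finite) set" and m :: "real ^ 's"
  assumes "integral_base_polyhedron B"
    and "m \<in> B \<inter> integer_vectors"
  shows "minimizes_over difference_sum (B \<inter> integer_vectors) m \<longleftrightarrow>
         decreasingly_minimal (B \<inter> integer_vectors) m"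
proof -
  obtain b where b: "integer_valued b" "submodular b" "b {} = 0" and B: "B = base_polyhedron b"
    using assms(1) by (auto simp: integral_base_polyhedron_def)
  \<comment> \<open>Both kinds of minimality are shown equivalent to this condition, which mentions
    neither objective.\<close>
  let ?local = "\<forall>s t. m $ s + 2 \<le> m $ t \<longrightarrow> transfer m s t \<notin> B"
  have m: "m \<in> base_polyhedron b" "m \<in> integer_vectors" using assms(2) by (auto simp: B)
  have *: "difference_sum m \<le> difference_sum y \<and> dec_le m y"
    if ?local "y \<in> B \<inter> integer_vectors" for y
    using no_tightening_imp_minimal[OF b m, of y] that by (auto simp: B)
  have "difference_sum (transfer m s t) < difference_sum m" if "m $ s + 2 \<le> m $ t" for s t
    proof -
    have "m $ s + 1 \<le> m $ t" using that by simp
    from difference_sum_transfer_le[OF this] that show ?thesis by simp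
  qed
  then have "minimizes_over difference_sum (B \<inter> integer_vectors) m \<longleftrightarrow> ?local"
    using * assms(2) transfer_integer[OF m(2)] unfolding minimizes_over_def
    by (meson IntI linorder_not_le)
  moreover have "\<not> dec_le m (transfer m s t)" if "m $ s + 2 \<le> m $ t" for s t
    using dec_sorted_tightening[OF that] by (rule not_dec_le_if_lexord)
  then have "decreasingly_minimal (B \<inter> integer_vectors) m \<longleftrightarrow> ?local"
    using * assms(2) transfer_integer[OF m(2)] unfolding decreasingly_minimal_def
    by (meson IntI)
  ultimately show ?thesis by simp
qed

end
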